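(* Let $A$ be a real $n\times n$ matrix, with Lyapunov operator $L_A$ and Stein operator $S_A$. The following are true: (a) If $A^2=-I$, then $L_A$ and $S_A$ are both trivially range monotone. (b) If $A^2=I$, then $S_A$ is trivially range monotone. (c) If $A^T=-A$, then $L_A$ is trivially range monotone.
   Context: $\mathcal{S}^n$ denotes the real vector space of real symmetric $n\times n$ matrices, and $X\succeq 0$ means that the symmetric matrix $X$ is positive semidefinite. For a real $n\times n$ matrix $A$, the Lyapunov operator $L_A:\mathcal{S}^n\to\mathcal{S}^n$ is $L_A(X)=AX+XA^T$, and the Stein operator $S_A:\mathcal{S}^n\to\mathcal{S}^n$ is $S_A(X)=X-AXA^T$. For a linear operator $T:\mathcal{S}^n\to\mathcal{S}^n$, $R(T)$ denotes its range. $T$ is called trivially range monotone if for every $X\in R(T)$, $T(X)\succeq 0$ implies $X=0$. *)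

theory Defs
  imports "HOL-Analysis.Analysis"
begin

definition sym_matrices :: "(real ^ 'n ^ 'n) set" where
  "sym_matrices = {X. transpose X = X}"

definition pos_semidef :: "real ^ 'n ^ 'n \<Rightarrow> bool" where
  "pos_semidef X \<longleftrightarrow> X \<in> sym_matrices \<and> (\<forall>v. 0 \<le> v \<bullet> (X *v v))"

text \<open>
  Operators on the space of symmetric matrices are represented by functions on all square
  matrices; only their values on \<^const>\<open>sym_matrices\<close> matter.
\<close>

definition lyapunov_op :: "real ^ 'n ^ 'n \<Rightarrow> real ^ 'n ^ 'n \<Rightarrow> real ^ 'n ^ 'n" where
  "lyapunov_op A X = A ** X + X ** transpose A"

definition stein_op :: "real ^ 'n ^ 'n \<Rightarrow> real ^ 'n ^ 'n \<Rightarrow> real ^ 'n ^ 'n" where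
  "stein_op A X = X - A ** X ** transpose A"

text \<open>
  The range of an operator is its image of \<^const>\<open>sym_matrices\<close>, which in general is smaller
  than \<^term>\<open>range T\<close>.
\<close>

definition trivially_range_monotone :: "(real ^ 'n ^ 'n \<Rightarrow> real ^ 'n ^ 'n) \<Rightarrow> bool" where
  "trivially_range_monotone T \<longleftrightarrow>
    (\<forall>X \<in> T ` sym_matrices. pos_semidef (T X) \<longrightarrow> X = 0)"

lemma subspace_sym_matrices: "subspace (sym_matrices :: (real ^ 'n ^ 'n) set)"
  by (auto simp: subspace_def sym_matrices_def transpose_def vec_eq_iff)

lemma linear_lyapunov_op: "linear (lyapunov_op A)"
  by (rule linearI)
    (simp_all add: lyapunov_op_def matrix_matrix_mult_def vec_eq_iff sum.distrib
      sum_distrib_left algebra_simps)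

lemma linear_stein_op: "linear (stein_op A)"
  by (rule linearI)
    (simp_all add: stein_op_def matrix_matrix_mult_def vec_eq_iff sum.distrib
      sum_distrib_left sum_distrib_right algebra_simps)

lemma transpose_plus: "transpose (X + Y) = transpose X + transpose (Y :: real ^ 'n ^ 'n)"
  by (simp add: transpose_def vec_eq_iff)

lemma transpose_minus: "transpose (X - Y) = transpose X - transpose (Y :: real ^ 'n ^ 'n)"
  by (simp add: transpose_def vec_eq_iff)

lemma lyapunov_op_sym: "X \<in> sym_matrices \<Longrightarrow> lyapunov_op A X \<in> sym_matrices"
  by (simp add: sym_matrices_def lyapunov_op_def transpose_plus matrix_transpose_mul)

lemma stein_op_sym: "X \<in> sym_matrices \<Longrightarrow> stein_op A X \<in> sym_matrices"
  by (simp add: sym_matrices_def stein_op_def transpose_minus matrix_transpose_mul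
      matrix_mul_assoc)

end

theory Submission
  imports Defs
begin

text \<open>
  Each operator is applied twice: let \<open>Y = T X\<close> and \<open>Z = T Y\<close> with \<open>Z\<close> positive semidefinite.
  If \<open>A\<^sup>2 = \<plusminus>I\<close>, then in the cases concerned \<open>A Y A\<^sup>T = - Y\<close> and \<open>A Z A\<^sup>T = - Z\<close>. The latter
  makes \<open>Z\<close> also negative semidefinite, so \<open>Z = 0\<close>, and by the former \<open>Z = 2 Y\<close> (Stein) or
  \<open>A Z = - 2 Y\<close> (Lyapunov). If \<open>A\<close> is skew-symmetric, then \<open>Z\<close> is a commutator, so it has
  trace zero and vanishes; thus \<open>Y\<close> commutes with \<open>A\<close>, while it is itself a commutator with
  \<open>A\<close>, which makes \<open>Y\<close> orthogonal to itself.
\<close>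

lemma matrix_add_rdistrib: "((A :: real ^ 'n ^ 'm) + B) ** C = A ** C + B ** C"
  by (simp add: matrix_matrix_mult_def vec_eq_iff distrib_right sum.distrib)

lemma matrix_diff_ldistrib: "(A :: real ^ 'n ^ 'm) ** (B - C) = A ** B - A ** C"
  by (simp add: matrix_matrix_mult_def vec_eq_iff right_diff_distrib sum_subtractf)

lemma matrix_diff_rdistrib: "((A :: real ^ 'n ^ 'm) - B) ** C = A ** C - B ** C"
  by (simp add: matrix_matrix_mult_def vec_eq_iff left_diff_distrib sum_subtractf)

lemma matrix_minus_left: "(- (A :: real ^ 'n ^ 'm)) ** B = - (A ** B)"
  by (simp add: matrix_matrix_mult_def vec_eq_iff sum_negf)

lemma matrix_minus_right: "(A :: real ^ 'n ^ 'm) ** (- B) = - (A ** B)"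
  by (simp add: matrix_matrix_mult_def vec_eq_iff sum_negf)

lemma transpose_uminus: "transpose (- A) = - transpose (A :: real ^ 'n ^ 'm)"
  by (simp add: transpose_def vec_eq_iff)

lemma inner_axis_matrix_axis:
  fixes Z :: "real ^ 'n ^ 'm"
  shows "axis i 1 \<bullet> (Z *v axis j 1) = Z $ i $ j"
  by (simp add: inner_axis' matrix_vector_mult_basis column_def)

text \<open>The diagonal entries are nonnegative with sum zero, so each vanishes. The quadratic form
  at \<open>axis i 1 + axis j 1\<close> and \<open>axis i 1 - axis j 1\<close> then equals plus and
  minus twice \<open>Z $ i $ j\<close>, and both values are nonnegative.\<close>

lemma pos_semidef_trace_eq_0:
  fixes Z :: "real ^ 'n ^ 'n"
  assumes "pos_semidef Z" and "trace Z = 0"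
  shows "Z = 0"
proof -
  have nonneg: "0 \<le> v \<bullet> (Z *v v)" for v
    using assms(1) by (simp add: pos_semidef_def)
  have sym: "Z $ j $ i = Z $ i $ j" for i j
    using assms(1) by (metis (mono_tags, lifting) pos_semidef_def sym_matrices_def mem_Collect_eq
        transpose_def vec_lambda_beta)
  have "0 \<le> Z $ i $ i" for i
    using nonneg[of "axis i 1"] by (simp add: inner_axis_matrix_axis)
  then have diag: "Z $ i $ i = 0" for i
    using assms(2) by (simp add: trace_def sum_nonneg_eq_0_iff)
  have "Z $ i $ j = 0" for i j
  proof -
    have "0 \<le> Z $ i $ j"
      using nonneg[of "axis i 1 + axis j 1"] diag sym[of i j]
      by (simp add: matrix_vector_right_distrib inner_add_left inner_add_right
          inner_axis_matrix_axis)
    moreover have "Z $ i $ j \<le> 0"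
      using nonneg[of "axis i 1 - axis j 1"] diag sym[of i j]
      by (simp add: matrix_vector_mult_diff_distrib inner_diff_left inner_diff_right
          inner_axis_matrix_axis)
    ultimately show ?thesis by simp
  qed
  then show ?thesis by (simp add: vec_eq_iff)
qed

text \<open>Congruence preserves nonnegativity of the quadratic form, so \<open>Z\<close> and
  \<open>- Z\<close> both have nonnegative diagonal and the trace criterion applies.\<close>

lemma pos_semidef_congruence_eq_minus:
  fixes A Z :: "real ^ 'n ^ 'n"
  assumes "pos_semidef Z" and "A ** Z ** transpose A = - Z"
  shows "Z = 0"
proof (rule pos_semidef_trace_eq_0[OF assms(1)])
  have nonneg: "0 \<le> v \<bullet> (Z *v v)" for v
    using assms(1) by (simp add: pos_semidef_def)
  have "0 \<le> Z $ i $ i" for i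
    using nonneg[of "axis i 1"] by (simp add: inner_axis_matrix_axis)
  moreover have "0 \<le> (- Z) $ i $ i" for i
  proof -
    have "(- Z) $ i $ i = axis i 1 \<bullet> ((A ** Z ** transpose A) *v axis i 1)"
      by (simp only: inner_axis_matrix_axis assms(2))
    also have "\<dots> = (transpose A *v axis i 1) \<bullet> (Z *v (transpose A *v axis i 1))"
      by (simp add: dot_lmul_matrix transpose_matrix_vector flip: matrix_vector_mul_assoc)
    finally show ?thesis using nonneg by simp
  qed
  ultimately have "Z $ i $ i = 0" for i
    by (simp add: order_antisym)
  then show "trace Z = 0" by (simp add: trace_def)
qed

text \<open>The congruence swaps the two summands up to sign: \<open>A ** X\<close> goes to
  \<open>- (X ** transpose A)\<close> and \<open>X ** transpose A\<close> to
  \<open>- (A ** X)\<close>.\<close>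

lemma lyapunov_op_congruence:
  fixes A X :: "real ^ 'n ^ 'n"
  assumes "A ** A = - mat 1"
  shows "A ** lyapunov_op A X ** transpose A = - lyapunov_op A X"
proof -
  have "transpose A ** transpose A = - mat 1"
    using assms by (metis matrix_transpose_mul transpose_uminus transpose_mat)
  moreover have "A ** lyapunov_op A X ** transpose A
      = (A ** A) ** X ** transpose A + A ** X ** (transpose A ** transpose A)"
    by (simp add: lyapunov_op_def matrix_add_ldistrib matrix_add_rdistrib matrix_mul_assoc)
  ultimately show ?thesis
    using assms by (simp add: lyapunov_op_def matrix_minus_left matrix_minus_right)
qed

text \<open>For either sign of the square, the congruence C by \<open>A\<close> is an involution,
  because the sign occurs twice and cancels. Hence C(X - C X) = C X - X.\<close>

lemma stein_op_congruence:
  fixes A X :: "real ^ 'n ^ 'n"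
  assumes "A ** A = mat 1 \<or> A ** A = - mat 1"
  shows "A ** stein_op A X ** transpose A = - stein_op A X"
proof -
  have "A ** stein_op A X ** transpose A
      = A ** X ** transpose A - (A ** A) ** X ** transpose (A ** A)"
    by (simp add: stein_op_def matrix_diff_ldistrib matrix_diff_rdistrib matrix_mul_assoc
        matrix_transpose_mul)
  also have "(A ** A) ** X ** transpose (A ** A) = X"
    using assms
    by (auto simp: matrix_minus_left matrix_minus_right transpose_uminus transpose_mat)
  finally show ?thesis by (simp add: stein_op_def)
qed

lemma trivially_range_monotone_lyapunov_op_skew_involution:
  fixes A :: "real ^ 'n ^ 'n"
  assumes "A ** A = - mat 1"
  shows "trivially_range_monotone (lyapunov_op A)"
  unfolding trivially_range_monotone_def
proof (intro ballI impI)
  fix Y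
  assume "Y \<in> lyapunov_op A ` sym_matrices" and psd: "pos_semidef (lyapunov_op A Y)"
  then obtain X where Y: "Y = lyapunov_op A X" by blast
  have "lyapunov_op A Y = 0"
    using pos_semidef_congruence_eq_minus[OF psd] lyapunov_op_congruence[OF assms] by blast
  \<comment> \<open>Multiplying by \<open>A\<close> turns both summands into \<open>- Y\<close>: the
    first by the hypothesis on \<open>A ** A\<close>, the second by the congruence identity for
    \<open>Y\<close>.\<close>
  then have "A ** (A ** Y + Y ** transpose A) = 0"
    by (simp add: lyapunov_op_def)
  then have "(A ** A) ** Y + A ** Y ** transpose A = 0"
    by (simp add: matrix_add_ldistrib matrix_mul_assoc)
  then have "- Y - Y = 0"
    using lyapunov_op_congruence[OF assms, of X] by (simp add: assms matrix_minus_left Y)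
  then show "Y = 0" by (simp add: vec_eq_iff)
qed

lemma trivially_range_monotone_stein_op:
  fixes A :: "real ^ 'n ^ 'n"
  assumes "A ** A = mat 1 \<or> A ** A = - mat 1"
  shows "trivially_range_monotone (stein_op A)"
  unfolding trivially_range_monotone_def
proof (intro ballI impI)
  fix Y
  assume "Y \<in> stein_op A ` sym_matrices" and psd: "pos_semidef (stein_op A Y)"
  then obtain X where Y: "Y = stein_op A X" by blast
  have "stein_op A Y = 0"
    using pos_semidef_congruence_eq_minus[OF psd] stein_op_congruence[OF assms] by blast
  moreover have "stein_op A Y = Y + Y"
    unfolding stein_op_def[of A Y] using stein_op_congruence[OF assms, of X] by (simp add: Y)
  ultimately show "Y = 0" by (simp add: vec_eq_iff)
qed

text \<open>The trace is the sum of the squares of all entries of \<open>Y\<close>.\<close>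

lemma trace_mult_transpose_eq_0_iff:
  fixes Y :: "real ^ 'n ^ 'm"
  shows "trace (Y ** transpose Y) = 0 \<longleftrightarrow> Y = 0"
  by (simp add: trace_def matrix_matrix_mult_def transpose_def vec_eq_iff sum_nonneg
      sum_nonneg_eq_0_iff)

lemma trivially_range_monotone_lyapunov_op_skew:
  fixes A :: "real ^ 'n ^ 'n"
  assumes skew: "transpose A = - A"
  shows "trivially_range_monotone (lyapunov_op A)"
  unfolding trivially_range_monotone_def
proof (intro ballI impI)
  fix Y
  assume "Y \<in> lyapunov_op A ` sym_matrices" and psd: "pos_semidef (lyapunov_op A Y)"
  then obtain X where X: "X \<in> sym_matrices" and Y: "Y = lyapunov_op A X" by blast
  have commutator: "lyapunov_op A B = A ** B - B ** A" for B
    by (simp add: lyapunov_op_def skew matrix_minus_right)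
  have "lyapunov_op A Y = 0"
    by (rule pos_semidef_trace_eq_0[OF psd])
      (simp add: commutator trace_sub trace_mul_sym[of A])
  then have commute: "A ** Y = Y ** A"
    by (simp add: commutator)
  \<comment> \<open>\<open>Y\<close> is symmetric, so the second factor may be replaced by the
    commutator of \<open>A\<close> and \<open>X\<close>. Since \<open>Y\<close> commutes with
    \<open>A\<close>, the product is again a commutator, now of \<open>A\<close> and
    \<open>Y ** X\<close>, and has trace zero.\<close>
  have "Y ** transpose Y = Y ** lyapunov_op A X"
    using lyapunov_op_sym[OF X, of A] by (simp add: sym_matrices_def Y)
  also have "\<dots> = A ** (Y ** X) - (Y ** X) ** A"
    by (simp add: commutator matrix_diff_ldistrib matrix_mul_assoc commute)
  finally have "trace (Y ** transpose Y) = 0"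
    by (simp add: trace_sub trace_mul_sym[of A])
  then show "Y = 0" by (simp only: trace_mult_transpose_eq_0_iff)
qed

theorem theorem3p17:
  fixes A :: "real ^ 'n ^ 'n"
  shows "(A ** A = - mat 1 \<longrightarrow>
            trivially_range_monotone (lyapunov_op A) \<and> trivially_range_monotone (stein_op A)) \<and>
         (A ** A = mat 1 \<longrightarrow> trivially_range_monotone (stein_op A)) \<and>
         (transpose A = - A \<longrightarrow> trivially_range_monotone (lyapunov_op A))"
  by (simp add: trivially_range_monotone_lyapunov_op_skew_involution
      trivially_range_monotone_stein_op trivially_range_monotone_lyapunov_op_skew)

end
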